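(* For every CFL number $\mathtt C>0$ and every $\theta\in(0,1]$, the 2D standard central DG method is not always positivity-preserving, even under the nodal admissibility condition, when the discrete divergence-free condition is violated. Precisely: for every $\mathtt C>0$ and every $\theta\in(0,1]$ there exist an equation of state, a polynomial degree $k\ge0$, overlapping uniform meshes with step sizes $\Delta x,\Delta y$, and numerical solutions $\mathbf U_h^C$ (componentwise a polynomial of total degree at most $k$ on each primal cell) and $\mathbf U_h^D$ (componentwise a polynomial of total degree at most $k$ on each dual cell) such that 1. all cell averages $\overline{\mathbf U}_{ij}^C$, $\overline{\mathbf U}_{i+\frac12,j+\frac12}^D$ belong to $G$, and $\mathbf U_h^C(x,y)\in G$, $\mathbf U_h^D(x,y)\in G$ for all $(x,y)\in\bigcup_{i,j}\mathbb Q_{ij}$, where $\mathbb Q_{ij}=(\mathbb Q_i^x\otimes\hat{\mathbb Q}_j^y)\cup(\hat{\mathbb Q}_i^x\otimes\mathbb Q_j^y)$; 2. the discrete divergence-free condition "$\mathrm{div}_{ij}\mathbf B_h^D=0$ and $\mathrm{div}_{i+\frac12,j+\frac12}\mathbf B_h^C=0$ for all $i,j$" is violated; 3. with $\tau_{\max}$ determined by $\tau_{\max}\big(\frac{\hat a_1}{\Delta x}+\frac{\hat a_2}{\Delta y}\big)=\mathtt C$ and $\Delta t=\theta\tau_{\max}$, the positivity-preserving property $$\overline{\mathbf U}_{ij}^C+\Delta t\,\mathcal L_{ij}(\mathbf U_h^C,\mathbf U_h^D)\in G,\qquad \overline{\mathbf U}_{i+\frac12,j+\frac12}^D+\Delta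 t\,\mathcal L_{i+\frac12,j+\frac12}(\mathbf U_h^D,\mathbf U_h^C)\in G\qquad\forall i,j$$ fails.
   Context: **Ideal MHD.** States are $\mathbf U=(\rho,\mathbf m,\mathbf B,E)^\top\in\mathbb R^8$ with $\mathbf m,\mathbf B\in\mathbb R^3$. Put $\mathbf v=\mathbf m/\rho$, $\mathcal E(\mathbf U)=E-\frac{|\mathbf m|^2}{2\rho}-\frac{|\mathbf B|^2}{2}=\rho e$ (this defines the specific internal energy $e$), and $p=p(\rho,e)$ given by an equation of state for which $p>0\Leftrightarrow e>0$ when $\rho>0$ (for example the ideal one, $p=(\gamma-1)\rho e$ with a constant $\gamma>1$). The flux in direction $\ell$ is $$\mathbf F_\ell(\mathbf U)=\Big(\rho v_\ell,\ v_\ell\mathbf m-B_\ell\mathbf B+(p+\tfrac12|\mathbf B|^2)\mathbf e_\ell,\ v_\ell\mathbf B-B_\ell\mathbf v,\ v_\ell(E+p+\tfrac12|\mathbf B|^2)-B_\ell(\mathbf v\cdot\mathbf B)\Big)^\top,$$ with $\mathbf e_\ell$ the $\ell$th column of the $3\times3$ identity matrix. The admissible set is $G=\{\mathbf U:\rho>0,\ \mathcal E(\mathbf U)>0\}$. **Wave speed bound.** For $\mathbf U,\tilde{\mathbf U}\in G$ (tilde denotes quantities of $\tilde{\mathbf U}$), $$\alpha_\ell(\mathbf U,\tilde{\mathbf U})=\max\Big\{|v_\ell|+\mathcal C_\ell,\ |\tilde v_\ell|+\tilde{\mathcal C}_\ell,\ \frac{|\sqrt\rho v_\ell+\sqrt{\tilde\rho}\tilde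 v_\ell|}{\sqrt\rho+\sqrt{\tilde\rho}}+\max\{\mathcal C_\ell,\tilde{\mathcal C}_\ell\}\Big\}+\frac{|\mathbf B-\tilde{\mathbf B}|}{\sqrt\rho+\sqrt{\tilde\rho}},$$ $$\mathcal C_\ell=\frac1{\sqrt2}\Big[\frac{|\mathbf B|^2}{\rho}+\mathcal C_s^2+\sqrt{\big(\tfrac{|\mathbf B|^2}{\rho}+\mathcal C_s^2\big)^2-4\tfrac{B_\ell^2\mathcal C_s^2}{\rho}}\Big]^{1/2},\qquad \mathcal C_s=\frac{p}{\rho\sqrt{2e}} .$$ **Meshes.** A rectangle is covered by two overlapping uniform meshes with step sizes $\Delta x,\Delta y$: primal cells $I_{i,j}=(x_{i-\frac12},x_{i+\frac12})\times(y_{j-\frac12},y_{j+\frac12})$ with center $(x_i,y_j)$, and dual cells $I_{i+\frac12,j+\frac12}=(x_i,x_{i+1})\times(y_j,y_{j+1})$. Indices $i,j$ range over all mesh indices; values needed beyond the boundary are supplied by boundary conditions. $\mathbf B_h^C=(B_{1,h}^C,B_{2,h}^C,B_{3,h}^C)$ and $\mathbf B_h^D$ are the magnetic components of $\mathbf U_h^C,\mathbf U_h^D$. For $\star\in\{C,D\}$, $\overline{\mathbf U}^\star_{ij}$ and $\overline{\mathbf U}^\star_{i+\frac12,j+\frac12}$ denote the averages of $\mathbf U_h^\star$ over $I_{i,j}$ and $I_{i+\frac12,j+\frac12}$. **Quadrature.** Let $N=k+1$, $L=\lceil\frac{k+3}2\rceil$. $\{x_{i\pm\frac14}^{(\mu)}\}_{\mu=1}^N$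 are the $N$-point Gauss nodes on the half-intervals: subscript $i-\frac14$ refers to $[x_{i-\frac12},x_i]$, subscript $i+\frac14$ to $[x_i,x_{i+\frac12}]$; weights $\omega_\mu$, $\sum_\mu\omega_\mu=1$; $\mathbb Q_i^x$ is the union of these two node sets. $\{\hat x_{i\pm\frac14}^{(\nu)}\}_{\nu=1}^L$ are the $L$-point Gauss–Lobatto nodes (endpoints included) on the same half-intervals, and $\hat{\mathbb Q}_i^x$ is their union. The sets $\mathbb Q_j^y,\hat{\mathbb Q}_j^y$ and nodes $y_{j\pm\frac14}^{(\mu)}$ are defined likewise. The same convention is used for shifted subscripts (e.g. $i+\frac12\pm\frac14$ refers to the half-intervals $[x_i,x_{i+\frac12}]$ and $[x_{i+\frac12},x_{i+1}]$). At nodes where a piecewise polynomial is discontinuous, its value is the one-sided limit from within the half-interval to which the node belongs (both limits, if it belongs to both). **Scheme (cell averages of the standard central DG method).** $$\mathcal L_{ij}(\mathbf U_h^C,\mathbf U_h^D)=\frac{\overline{\mathbf U}_{ij}^D-\overline{\mathbf U}_{ij}^C}{\tau_{\max}}-\frac1{\Delta x}\sum_{\sigma=\pm1}\sum_{\mu=1}^N\frac{\omega_\mu}2\Big(\mathbf F_1(\mathbf U_h^D(x_{i+\frac12},y_{j+\frac\sigma4}^{(\mu)}))-\mathbf F_1(\mathbf U_h^D(x_{i-\frac12},y_{j+\frac\sigma4}^{(\mu)}))\Big)$$ $$\qquad-\frac1{\Delta y}\sum_{\sigma=\pm1}\sum_{\mu=1}^N\frac{\omega_\mu}2\Big(\mathbf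 F_2(\mathbf U_h^D(x_{i+\frac\sigma4}^{(\mu)},y_{j+\frac12}))-\mathbf F_2(\mathbf U_h^D(x_{i+\frac\sigma4}^{(\mu)},y_{j-\frac12}))\Big),$$ and $\mathcal L_{i+\frac12,j+\frac12}(\mathbf U_h^D,\mathbf U_h^C)$ is the same expression with the roles of $C$ and $D$ exchanged and $i,j$ replaced by $i+\frac12,j+\frac12$ everywhere. **Discrete divergence.** $$\mathrm{div}_{ij}\mathbf B_h^D=\frac1{\Delta x}\sum_{\sigma=\pm1}\sum_{\mu=1}^N\frac{\omega_\mu}2\Big(B_{1,h}^D(x_{i+\frac12},y_{j+\frac\sigma4}^{(\mu)})-B_{1,h}^D(x_{i-\frac12},y_{j+\frac\sigma4}^{(\mu)})\Big)+\frac1{\Delta y}\sum_{\sigma=\pm1}\sum_{\mu=1}^N\frac{\omega_\mu}2\Big(B_{2,h}^D(x_{i+\frac\sigma4}^{(\mu)},y_{j+\frac12})-B_{2,h}^D(x_{i+\frac\sigma4}^{(\mu)},y_{j-\frac12})\Big),$$ and $\mathrm{div}_{i+\frac12,j+\frac12}\mathbf B_h^C$ is the same with $D\to C$, $(i,j)\to(i+\frac12,j+\frac12)$. **Wave speeds.** $$\hat a_1=\max_{i,j}\max_{y\in\mathbb Q_j^y}\big\{\alpha_1(\mathbf U_h^C(x_{i+1},y),\mathbf U_h^C(x_i,y)),\ \alpha_1(\mathbf U_h^D(x_{i+\frac12},y),\mathbf U_h^D(x_{i-\frac12},y))\big\},$$ $$\hat a_2=\max_{i,j}\max_{x\in\mathbb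 Q_i^x}\big\{\alpha_2(\mathbf U_h^C(x,y_{j+1}),\mathbf U_h^C(x,y_j)),\ \alpha_2(\mathbf U_h^D(x,y_{j+\frac12}),\mathbf U_h^D(x,y_{j-\frac12}))\big\}.$$ *)

theory Defs
  imports "HOL-Analysis.Analysis" "HOL-Computational_Algebra.Polynomial"
begin

section \<open>Ideal MHD\<close>

text \<open>States \<open>(\<rho>, m, B, E)\<close> form an eight-dimensional Euclidean space.\<close>

type_synonym state = "real \<times> (real^3) \<times> (real^3) \<times> real"

definition dens :: "state \<Rightarrow> real" where
  "dens U = fst U"

definition mom :: "state \<Rightarrow> real^3" where
  "mom U = fst (snd U)"

definition mag :: "state \<Rightarrow> real^3" where
  "mag U = fst (snd (snd U))"

definition energy :: "state \<Rightarrow> real" where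
  "energy U = snd (snd (snd U))"

definition vel :: "state \<Rightarrow> real^3" where
  "vel U = (1 / dens U) *\<^sub>R mom U"

definition internal_energy :: "state \<Rightarrow> real" where
  "internal_energy U = energy U - (norm (mom U))^2 / (2 * dens U) - (norm (mag U))^2 / 2"

definition spec_internal_energy :: "state \<Rightarrow> real" where
  "spec_internal_energy U = internal_energy U / dens U"

definition admissible :: "state set" where
  "admissible = {U. dens U > 0 \<and> internal_energy U > 0}"

text \<open>An equation of state is the function \<open>(\<rho>, e) \<mapsto> p(\<rho>, e)\<close>.\<close>

definition eos :: "(real \<Rightarrow> real \<Rightarrow> real) \<Rightarrow> bool" where
  "eos p \<longleftrightarrow> (\<forall>\<rho> e. \<rho> > 0 \<longrightarrow> (p \<rho> e > 0 \<longleftrightarrow> e > 0))"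

definition pressure :: "(real \<Rightarrow> real \<Rightarrow> real) \<Rightarrow> state \<Rightarrow> real" where
  "pressure p U = p (dens U) (spec_internal_energy U)"

definition flux :: "(real \<Rightarrow> real \<Rightarrow> real) \<Rightarrow> 3 \<Rightarrow> state \<Rightarrow> state" where
  "flux p l U =
    (let v = vel U; B = mag U; ptot = pressure p U + (norm B)^2 / 2
     in (dens U * v $ l,
         (v $ l) *\<^sub>R mom U - (B $ l) *\<^sub>R B + ptot *\<^sub>R axis l 1,
         (v $ l) *\<^sub>R B - (B $ l) *\<^sub>R v,
         v $ l * (energy U + ptot) - B $ l * (v \<bullet> B)))"

definition sound_speed :: "(real \<Rightarrow> real \<Rightarrow> real) \<Rightarrow> state \<Rightarrow> real" where
  "sound_speed p U = pressure p U / (dens U * sqrt (2 * spec_internal_energy U))"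

definition fast_speed :: "(real \<Rightarrow> real \<Rightarrow> real) \<Rightarrow> 3 \<Rightarrow> state \<Rightarrow> real" where
  "fast_speed p l U =
    (let s = (norm (mag U))^2 / dens U + (sound_speed p U)^2
     in 1 / sqrt 2 *
        sqrt (s + sqrt (s^2 - 4 * ((mag U $ l)^2 * (sound_speed p U)^2 / dens U))))"

definition wave_bound :: "(real \<Rightarrow> real \<Rightarrow> real) \<Rightarrow> 3 \<Rightarrow> state \<Rightarrow> state \<Rightarrow> real" where
  "wave_bound p l U W =
    Max {\<bar>vel U $ l\<bar> + fast_speed p l U,
         \<bar>vel W $ l\<bar> + fast_speed p l W,
         \<bar>sqrt (dens U) * vel U $ l + sqrt (dens W) * vel W $ l\<bar> / (sqrt (dens U) + sqrt (dens W))
           + max (fast_speed p l U) (fast_speed p l W)}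
    + norm (mag U - mag W) / (sqrt (dens U) + sqrt (dens W))"


section \<open>Gauss and Gauss--Lobatto quadrature\<close>

text \<open>Nodes on the reference interval \<open>[-1, 1]\<close>. The Gauss nodes are the zeros of the Legendre
  polynomial (given by Rodrigues' formula); the Gauss--Lobatto nodes with \<open>n \<ge> 2\<close> points are the
  endpoints and the zeros of the derivative of the Legendre polynomial of degree \<open>n - 1\<close>.
  The weights are those of interpolatory quadrature, divided by the length 2 of the reference
  interval, so that they sum to 1.\<close>

definition legendre :: "nat \<Rightarrow> real poly" where
  "legendre n = smult (1 / (2 ^ n * fact n)) ((pderiv ^^ n) ([:-1, 0, 1:] ^ n))"

definition gauss_nodes :: "nat \<Rightarrow> real set" where
  "gauss_nodes n = {\<xi>. poly (legendre n) \<xi> = 0}"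

definition lobatto_nodes :: "nat \<Rightarrow> real set" where
  "lobatto_nodes n = {-1, 1} \<union> {\<xi>. poly (pderiv (legendre (n - 1))) \<xi> = 0}"

definition gauss_weight :: "nat \<Rightarrow> real \<Rightarrow> real" where
  "gauss_weight n \<xi> =
    1 / 2 * integral {-1..1} (\<lambda>x. \<Prod>\<eta>\<in>gauss_nodes n - {\<xi>}. (x - \<eta>) / (\<xi> - \<eta>))"

definition num_gauss :: "nat \<Rightarrow> nat" where
  "num_gauss k = k + 1"

definition num_lobatto :: "nat \<Rightarrow> nat" where
  "num_lobatto k = nat \<lceil>(real k + 3) / 2\<rceil>"


section \<open>Overlapping uniform meshes\<close>

text \<open>The rectangle consists of \<open>nx * ny\<close> primal cells; \<open>(xorg, yorg)\<close> is the center of the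
  primal cell with indices \<open>(0, 0)\<close>.\<close>

record mesh =
  xorg :: real
  yorg :: real
  dx :: real
  dy :: real
  nx :: nat
  ny :: nat

definition valid_mesh :: "mesh \<Rightarrow> bool" where
  "valid_mesh M \<longleftrightarrow> dx M > 0 \<and> dy M > 0 \<and> nx M > 0 \<and> ny M > 0"

text \<open>Subscripts are real numbers: the primal cell \<open>(i, j)\<close> is \<open>cell M i j\<close>, the dual cell is
  \<open>cell M (i + 1/2) (j + 1/2)\<close>, and every notion depending on a cell is defined once for
  arbitrary real subscripts \<open>(r, s)\<close>.\<close>

definition xpt :: "mesh \<Rightarrow> real \<Rightarrow> real" where
  "xpt M r = xorg M + r * dx M"

definition ypt :: "mesh \<Rightarrow> real \<Rightarrow> real" where
  "ypt M s = yorg M + s * dy M"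

definition cell :: "mesh \<Rightarrow> real \<Rightarrow> real \<Rightarrow> (real \<times> real) set" where
  "cell M r s = {xpt M (r - 1/2)<..<xpt M (r + 1/2)} \<times> {ypt M (s - 1/2)<..<ypt M (s + 1/2)}"

text \<open>The product of the open half-intervals with midpoints \<open>xpt M r\<close> and \<open>ypt M s\<close>.\<close>

definition quarter_cell :: "mesh \<Rightarrow> real \<Rightarrow> real \<Rightarrow> (real \<times> real) set" where
  "quarter_cell M r s =
     {xpt M (r - 1/4)<..<xpt M (r + 1/4)} \<times> {ypt M (s - 1/4)<..<ypt M (s + 1/4)}"

text \<open>The node in the half-interval with subscript \<open>r\<close> (midpoint \<open>xpt M r\<close>, length \<open>dx M / 2\<close>)
  corresponding to the reference node \<open>\<xi> \<in> [-1, 1]\<close>.\<close>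

definition xnode :: "mesh \<Rightarrow> real \<Rightarrow> real \<Rightarrow> real" where
  "xnode M r \<xi> = xpt M r + dx M / 4 * \<xi>"

definition ynode :: "mesh \<Rightarrow> real \<Rightarrow> real \<Rightarrow> real" where
  "ynode M s \<eta> = ypt M s + dy M / 4 * \<eta>"

definition xindices :: "mesh \<Rightarrow> int set" where
  "xindices M = {0..<int (nx M)}"

definition yindices :: "mesh \<Rightarrow> int set" where
  "yindices M = {0..<int (ny M)}"

definition xgauss_set :: "mesh \<Rightarrow> nat \<Rightarrow> real \<Rightarrow> real set" where
  "xgauss_set M k r = (\<Union>\<sigma>\<in>{-1, 1}. xnode M (r + \<sigma>/4) ` gauss_nodes (num_gauss k))"

definition ygauss_set :: "mesh \<Rightarrow> nat \<Rightarrow> real \<Rightarrow> real set" where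
  "ygauss_set M k s = (\<Union>\<sigma>\<in>{-1, 1}. ynode M (s + \<sigma>/4) ` gauss_nodes (num_gauss k))"


section \<open>Numerical solutions\<close>

text \<open>A numerical solution is a function on the plane whose values on the cell interfaces are
  irrelevant. A vector-valued polynomial, with coefficients in the state space, is the same as a
  polynomial in each component.\<close>

definition poly_on :: "nat \<Rightarrow> (real \<times> real) set \<Rightarrow> (real \<times> real \<Rightarrow> state) \<Rightarrow> bool" where
  "poly_on k S U \<longleftrightarrow>
    (\<exists>c :: nat \<Rightarrow> nat \<Rightarrow> state. \<forall>(x, y)\<in>S.
       U (x, y) = (\<Sum>(a, b)\<in>{(a, b). a + b \<le> k}. (x ^ a * y ^ b) *\<^sub>R c a b))"

text \<open>Values beyond the boundary of the rectangle are supplied by periodic boundary conditions.\<close>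

definition periodic_ext :: "mesh \<Rightarrow> (real \<times> real \<Rightarrow> state) \<Rightarrow> bool" where
  "periodic_ext M U \<longleftrightarrow>
    (\<forall>x y. U (x + real (nx M) * dx M, y) = U (x, y) \<and> U (x, y + real (ny M) * dy M) = U (x, y))"

definition primal_solution :: "mesh \<Rightarrow> nat \<Rightarrow> (real \<times> real \<Rightarrow> state) \<Rightarrow> bool" where
  "primal_solution M k U \<longleftrightarrow> periodic_ext M U \<and>
    (\<forall>i\<in>xindices M. \<forall>j\<in>yindices M. poly_on k (cell M i j) U)"

definition dual_solution :: "mesh \<Rightarrow> nat \<Rightarrow> (real \<times> real \<Rightarrow> state) \<Rightarrow> bool" where
  "dual_solution M k U \<longleftrightarrow> periodic_ext M U \<and>
    (\<forall>i\<in>xindices M. \<forall>j\<in>yindices M. poly_on k (cell M (i + 1/2) (j + 1/2)) U)"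

definition cell_avg :: "mesh \<Rightarrow> (real \<times> real \<Rightarrow> state) \<Rightarrow> real \<Rightarrow> real \<Rightarrow> state" where
  "cell_avg M U r s = (1 / (dx M * dy M)) *\<^sub>R integral (cell M r s) U"


section \<open>The admissibility and divergence conditions\<close>

definition averages_admissible ::
    "mesh \<Rightarrow> (real \<times> real \<Rightarrow> state) \<Rightarrow> (real \<times> real \<Rightarrow> state) \<Rightarrow> bool" where
  "averages_admissible M UC UD \<longleftrightarrow>
    (\<forall>i\<in>xindices M. \<forall>j\<in>yindices M.
       cell_avg M UC i j \<in> admissible \<and> cell_avg M UD (i + 1/2) (j + 1/2) \<in> admissible)"

text \<open>The value at a node is the one-sided limit from the quarter cell to which it belongs; nodes
  belonging to several quarter cells are visited once for each of them.\<close>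

definition nodal_admissible ::
    "mesh \<Rightarrow> nat \<Rightarrow> (real \<times> real \<Rightarrow> state) \<Rightarrow> bool" where
  "nodal_admissible M k U \<longleftrightarrow>
    (\<forall>i\<in>xindices M. \<forall>j\<in>yindices M. \<forall>\<sigma>\<in>{-1, 1::real}. \<forall>\<sigma>'\<in>{-1, 1::real}.
      \<forall>(\<xi>, \<eta>)\<in>gauss_nodes (num_gauss k) \<times> lobatto_nodes (num_lobatto k)
              \<union> lobatto_nodes (num_lobatto k) \<times> gauss_nodes (num_gauss k).
        Lim (at (xnode M (i + \<sigma>/4) \<xi>, ynode M (j + \<sigma>'/4) \<eta>)
             within quarter_cell M (i + \<sigma>/4) (j + \<sigma>'/4)) U \<in> admissible)"

definition discrete_div :: "mesh \<Rightarrow> nat \<Rightarrow> (real \<times> real \<Rightarrow> state) \<Rightarrow> real \<Rightarrow> real \<Rightarrow> real" where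
  "discrete_div M k V r s =
     1 / dx M * (\<Sum>\<sigma>\<in>{-1, 1}. \<Sum>\<xi>\<in>gauss_nodes (num_gauss k). gauss_weight (num_gauss k) \<xi> / 2 *
        (mag (V (xpt M (r + 1/2), ynode M (s + \<sigma>/4) \<xi>)) $ 1
         - mag (V (xpt M (r - 1/2), ynode M (s + \<sigma>/4) \<xi>)) $ 1))
   + 1 / dy M * (\<Sum>\<sigma>\<in>{-1, 1}. \<Sum>\<xi>\<in>gauss_nodes (num_gauss k). gauss_weight (num_gauss k) \<xi> / 2 *
        (mag (V (xnode M (r + \<sigma>/4) \<xi>, ypt M (s + 1/2))) $ 2
         - mag (V (xnode M (r + \<sigma>/4) \<xi>, ypt M (s - 1/2))) $ 2))"

definition discrete_div_free ::
    "mesh \<Rightarrow> nat \<Rightarrow> (real \<times> real \<Rightarrow> state) \<Rightarrow> (real \<times> real \<Rightarrow> state) \<Rightarrow> bool" where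
  "discrete_div_free M k UC UD \<longleftrightarrow>
    (\<forall>i\<in>xindices M. \<forall>j\<in>yindices M.
       discrete_div M k UD i j = 0 \<and> discrete_div M k UC (i + 1/2) (j + 1/2) = 0)"


section \<open>The scheme for the cell averages\<close>

text \<open>\<open>cdg_op p M k \<tau> U V r s\<close> is the operator for the solution \<open>U\<close> living on the
  cell \<open>(r, s)\<close>, where \<open>V\<close> is the solution on the other mesh.\<close>

definition cdg_op :: "(real \<Rightarrow> real \<Rightarrow> real) \<Rightarrow> mesh \<Rightarrow> nat \<Rightarrow> real \<Rightarrow>
    (real \<times> real \<Rightarrow> state) \<Rightarrow> (real \<times> real \<Rightarrow> state) \<Rightarrow> real \<Rightarrow> real \<Rightarrow> state" where
  "cdg_op p M k \<tau> U V r s =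
     (1 / \<tau>) *\<^sub>R (cell_avg M V r s - cell_avg M U r s)
   - (1 / dx M) *\<^sub>R (\<Sum>\<sigma>\<in>{-1, 1}. \<Sum>\<xi>\<in>gauss_nodes (num_gauss k).
        (gauss_weight (num_gauss k) \<xi> / 2) *\<^sub>R
        (flux p 1 (V (xpt M (r + 1/2), ynode M (s + \<sigma>/4) \<xi>))
         - flux p 1 (V (xpt M (r - 1/2), ynode M (s + \<sigma>/4) \<xi>))))
   - (1 / dy M) *\<^sub>R (\<Sum>\<sigma>\<in>{-1, 1}. \<Sum>\<xi>\<in>gauss_nodes (num_gauss k).
        (gauss_weight (num_gauss k) \<xi> / 2) *\<^sub>R
        (flux p 2 (V (xnode M (r + \<sigma>/4) \<xi>, ypt M (s + 1/2)))
         - flux p 2 (V (xnode M (r + \<sigma>/4) \<xi>, ypt M (s - 1/2)))))"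

definition wave_speed1 :: "(real \<Rightarrow> real \<Rightarrow> real) \<Rightarrow> mesh \<Rightarrow> nat \<Rightarrow>
    (real \<times> real \<Rightarrow> state) \<Rightarrow> (real \<times> real \<Rightarrow> state) \<Rightarrow> real" where
  "wave_speed1 p M k UC UD =
    Max (\<Union>i\<in>xindices M. \<Union>j\<in>yindices M. \<Union>y\<in>ygauss_set M k j.
      {wave_bound p 1 (UC (xpt M (i + 1), y)) (UC (xpt M i, y)),
       wave_bound p 1 (UD (xpt M (i + 1/2), y)) (UD (xpt M (i - 1/2), y))})"

definition wave_speed2 :: "(real \<Rightarrow> real \<Rightarrow> real) \<Rightarrow> mesh \<Rightarrow> nat \<Rightarrow>
    (real \<times> real \<Rightarrow> state) \<Rightarrow> (real \<times> real \<Rightarrow> state) \<Rightarrow> real" where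
  "wave_speed2 p M k UC UD =
    Max (\<Union>i\<in>xindices M. \<Union>j\<in>yindices M. \<Union>x\<in>xgauss_set M k i.
      {wave_bound p 2 (UC (x, ypt M (j + 1))) (UC (x, ypt M j)),
       wave_bound p 2 (UD (x, ypt M (j + 1/2))) (UD (x, ypt M (j - 1/2)))})"

definition positivity_preserving :: "(real \<Rightarrow> real \<Rightarrow> real) \<Rightarrow> mesh \<Rightarrow> nat \<Rightarrow> real \<Rightarrow> real \<Rightarrow>
    (real \<times> real \<Rightarrow> state) \<Rightarrow> (real \<times> real \<Rightarrow> state) \<Rightarrow> bool" where
  "positivity_preserving p M k \<tau> \<Delta>t UC UD \<longleftrightarrow>
    (\<forall>i\<in>xindices M. \<forall>j\<in>yindices M.
       cell_avg M UC i j + \<Delta>t *\<^sub>R cdg_op p M k \<tau> UC UD i j \<in> admissible \<and>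
       cell_avg M UD (i + 1/2) (j + 1/2) + \<Delta>t *\<^sub>R cdg_op p M k \<tau> UD UC (i + 1/2) (j + 1/2)
         \<in> admissible)"

end

theory Submission
  imports Defs
begin

text \<open>
  A magnetic field \<open>B = (b, 0, 0)\<close> with a jump \<open>2 \<delta>\<close> in the \<open>x\<close>-direction has nonzero divergence.
  With equal velocities \<open>(1, 0, 0)\<close> on both sides, the jump acts through the flux of the momentum
  \<open>m\<^sub>1\<close> alone and increases \<open>m\<^sub>1\<close> by an amount of first order in \<open>\<delta>\<close>, while all other cell averages
  stay unchanged. The kinetic energy therefore grows by an amount of order \<open>\<delta>\<close> at the expense of
  the internal energy, which for nearly pressureless data is only of order \<open>\<delta>\<^sup>2\<close>. The wave speeds
  remain bounded, hence \<open>\<Delta>t\<close> is bounded below as \<open>\<delta> \<rightarrow> 0\<close>, and the internal energy becomes negative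
  for small \<open>\<delta>\<close>. The primal data are the average of the two dual states, so the CFL-independent part
  of the scheme does not interfere.
  Piecewise constant data (\<open>k = 0\<close>) suffice.
\<close>

section \<open>Wave speeds\<close>

text \<open>With s = |B|^2/rho + Cs^2, the inner radicand lies between 0 and s^2: |B_l| \<le> |B|
  and 4Ac \<le> (A+c)^2 give its sign. So the inner root is at most s and the speed at most sqrt
  s.\<close>

lemma fast_speed_bounds:
  assumes "dens U > 0"
  shows "0 \<le> fast_speed p l U"
    and "fast_speed p l U \<le> sqrt ((norm (mag U))\<^sup>2 / dens U + (sound_speed p U)\<^sup>2)"
proof -
  define c where "c = (sound_speed p U)\<^sup>2"
  define A where "A = (norm (mag U))\<^sup>2 / dens U"
  define t where "t = (mag U $ l)\<^sup>2 * c / dens U"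
  have c0: "c \<ge> 0" and A0: "A \<ge> 0" and t0: "t \<ge> 0"
    using assms by (auto simp: c_def A_def t_def)
  have "(mag U $ l)\<^sup>2 \<le> (norm (mag U))\<^sup>2"
    using component_le_norm_cart[of "mag U" l] by (metis abs_le_square_iff abs_norm_cancel)
  then have "t \<le> A * c"
    unfolding t_def A_def using assms c0 by (simp add: divide_right_mono mult_right_mono)
  moreover have "4 * (A * c) \<le> (A + c)\<^sup>2"
    using zero_le_power2[of "A - c"] by (simp add: power2_eq_square algebra_simps)
  ultimately have root: "0 \<le> sqrt ((A + c)\<^sup>2 - 4 * t)"
    by simp
  have "sqrt ((A + c)\<^sup>2 - 4 * t) \<le> sqrt ((A + c)\<^sup>2)"
    using t0 by (intro real_sqrt_le_mono) simp
  also have "\<dots> = A + c"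
    using A0 c0 by simp
  finally have upper: "sqrt ((A + c)\<^sup>2 - 4 * t) \<le> A + c" .
  have fs: "fast_speed p l U = 1 / sqrt 2 * sqrt (A + c + sqrt ((A + c)\<^sup>2 - 4 * t))"
    by (simp add: fast_speed_def Let_def A_def c_def t_def)
  show "0 \<le> fast_speed p l U"
    unfolding fs using root A0 c0 by simp
  have "sqrt (A + c + sqrt ((A + c)\<^sup>2 - 4 * t)) \<le> sqrt (2 * (A + c))"
    using upper by (intro real_sqrt_le_mono) simp
  then have "fast_speed p l U \<le> sqrt (A + c)"
    unfolding fs real_sqrt_mult by (simp add: divide_le_eq mult.commute)
  then show "fast_speed p l U \<le> sqrt ((norm (mag U))\<^sup>2 / dens U + (sound_speed p U)\<^sup>2)"
    by (simp add: A_def c_def)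
qed

text \<open>Serves to keep the sum of the wave speeds positive, so that the CFL number can be
  divided by it.\<close>

lemma wave_bound_ge_vel:
  assumes "dens U > 0" "dens W > 0"
  shows "\<bar>vel U $ l\<bar> \<le> wave_bound p l U W"
proof -
  have "0 \<le> norm (mag U - mag W) / (sqrt (dens U) + sqrt (dens W))"
    using assms by simp
  moreover have "\<bar>vel U $ l\<bar> \<le> \<bar>vel U $ l\<bar> + fast_speed p l U"
    using fast_speed_bounds(1)[OF assms(1)] by simp
  ultimately show ?thesis
    unfolding wave_bound_def by (simp add: le_max_iff_disj)
qed


section \<open>Quadrature for piecewise constants\<close>

text \<open>For degree 0 the Gauss rule is the midpoint rule and the Lobatto rule has only the
  endpoints; this polynomial settles both.\<close>

lemma legendre_1: "legendre (Suc 0) = [:0, 1:]"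
  by (simp add: legendre_def pderiv_pCons)

lemma gauss_nodes_1: "gauss_nodes (Suc 0) = {0}"
  by (auto simp: gauss_nodes_def legendre_1)

lemma gauss_weight_1: "gauss_weight (Suc 0) 0 = 1"
  by (simp add: gauss_weight_def gauss_nodes_1)

lemma lobatto_nodes_2: "lobatto_nodes 2 = {-1, 1}"
  by (simp add: lobatto_nodes_def legendre_1 pderiv_pCons)

lemma num_gauss_0: "num_gauss 0 = Suc 0"
  by (simp add: num_gauss_def)

lemma num_lobatto_0: "num_lobatto 0 = 2"
proof -
  have "\<lceil>3 / 2 :: real\<rceil> = 2"
    by (simp add: ceiling_eq_iff)
  then show ?thesis
    by (simp add: num_lobatto_def)
qed


section \<open>Piecewise constant solutions\<close>

lemma poly_on_const:
  assumes "\<And>z. z \<in> S \<Longrightarrow> U z = w"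
  shows "poly_on 0 S U"
  unfolding poly_on_def
proof (intro exI ballI, clarify)
  fix x y assume "(x, y) \<in> S"
  have "{(a, b). a + b \<le> (0::nat)} = {(0, 0)}"
    by auto
  then show "U (x, y) = (\<Sum>(a, b)\<in>{(a, b). a + b \<le> 0}. (x ^ a * y ^ b) *\<^sub>R w)"
    using assms[OF \<open>(x, y) \<in> S\<close>] by simp
qed

lemma cell_eq_box:
  "cell M r s = box (xpt M (r - 1/2), ypt M (s - 1/2)) (xpt M (r + 1/2), ypt M (s + 1/2))"
  by (simp add: cell_def box_prod)

text \<open>Interface values are arbitrary, so \<open>U\<close> is compared with the constant on the
  open box only; the closed box serves to evaluate the integral of the constant.\<close>

lemma has_integral_const_box:
  fixes a b :: "real \<times> real" and w :: "'c::euclidean_space"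
  assumes "\<And>z. z \<in> box a b \<Longrightarrow> U z = w" and "fst a \<le> fst b" "snd a \<le> snd b"
  shows "(U has_integral ((fst b - fst a) * (snd b - snd a)) *\<^sub>R w) (box a b)"
proof -
  obtain a1 a2 b1 b2 where ab: "a = (a1, a2)" "b = (b1, b2)"
    by (metis surj_pair)
  have "measure lborel (cbox a b) = (fst b - fst a) * (snd b - snd a)"
    using assms(2,3) by (simp add: ab content_Pair)
  then have "((\<lambda>_. w) has_integral ((fst b - fst a) * (snd b - snd a)) *\<^sub>R w) (cbox a b)"
    using has_integral_const[of w a b] by simp
  then have "((\<lambda>_. w) has_integral ((fst b - fst a) * (snd b - snd a)) *\<^sub>R w) (box a b)"
    by (simp add: has_integral_open_interval)
  then show ?thesis
    using assms(1) by (simp cong: has_integral_cong)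
qed

lemma cell_avg_const:
  assumes "dx M > 0" "dy M > 0" and const: "\<And>z. z \<in> cell M r s \<Longrightarrow> U z = w"
  shows "cell_avg M U r s = w"
proof -
  have "(U has_integral (dx M * dy M) *\<^sub>R w) (cell M r s)"
    using has_integral_const_box[of "(xpt M (r - 1/2), ypt M (s - 1/2))"
        "(xpt M (r + 1/2), ypt M (s + 1/2))" U w] assms
    by (simp add: cell_eq_box xpt_def ypt_def algebra_simps)
  then show ?thesis
    using assms(1,2) by (simp add: cell_avg_def integral_unique)
qed

lemma cell_avg_two_halves:
  assumes "dx M > 0" "dy M > 0"
    and left: "\<And>x y. (x, y) \<in> cell M r s \<Longrightarrow> x < xpt M r \<Longrightarrow> U (x, y) = w1"
    and right: "\<And>x y. (x, y) \<in> cell M r s \<Longrightarrow> xpt M r < x \<Longrightarrow> U (x, y) = w2"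
  shows "cell_avg M U r s = (1/2) *\<^sub>R (w1 + w2)"
proof -
  define L where "L = box (xpt M (r - 1/2), ypt M (s - 1/2)) (xpt M r, ypt M (s + 1/2))"
  define R where "R = box (xpt M r, ypt M (s - 1/2)) (xpt M (r + 1/2), ypt M (s + 1/2))"
  have L_eq: "L = {xpt M (r - 1/2)<..<xpt M r} \<times> {ypt M (s - 1/2)<..<ypt M (s + 1/2)}"
    and R_eq: "R = {xpt M r<..<xpt M (r + 1/2)} \<times> {ypt M (s - 1/2)<..<ypt M (s + 1/2)}"
    by (simp_all add: L_def R_def box_prod)
  have order: "xpt M (r - 1/2) < xpt M r" "xpt M r < xpt M (r + 1/2)"
    "ypt M (s - 1/2) \<le> ypt M (s + 1/2)"
    using assms(1,2) by (simp_all add: xpt_def ypt_def algebra_simps)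
  have "(U has_integral (dx M * dy M / 2) *\<^sub>R w1) L"
  proof -
    have const: "U z = w1" if "z \<in> L" for z
      using that left[of "fst z" "snd z"] order by (auto simp: L_eq cell_def)
    have "(xpt M r - xpt M (r - 1/2)) * (ypt M (s + 1/2) - ypt M (s - 1/2)) = dx M * dy M / 2"
      by (simp add: xpt_def ypt_def algebra_simps)
    then show ?thesis
      using has_integral_const_box[of "(xpt M (r - 1/2), ypt M (s - 1/2))"
          "(xpt M r, ypt M (s + 1/2))" U w1, folded L_def, OF const] order
      by (simp only: fst_conv snd_conv less_imp_le simp_thms)
  qed
  moreover have "(U has_integral (dx M * dy M / 2) *\<^sub>R w2) R"
  proof -
    have const: "U z = w2" if "z \<in> R" for z
      using that right[of "fst z" "snd z"] order by (auto simp: R_eq cell_def)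
    have "(xpt M (r + 1/2) - xpt M r) * (ypt M (s + 1/2) - ypt M (s - 1/2)) = dx M * dy M / 2"
      by (simp add: xpt_def ypt_def algebra_simps)
    then show ?thesis
      using has_integral_const_box[of "(xpt M r, ypt M (s - 1/2))"
          "(xpt M (r + 1/2), ypt M (s + 1/2))" U w2, folded R_def, OF const] order
      by (simp only: fst_conv snd_conv less_imp_le simp_thms)
  qed
  moreover have "L \<inter> R = {}"
    by (auto simp: L_eq R_eq)
  ultimately have
    "(U has_integral (dx M * dy M / 2) *\<^sub>R w1 + (dx M * dy M / 2) *\<^sub>R w2) (L \<union> R)"
    by (intro has_integral_Un) auto
  \<comment> \<open>\<open>U\<close> is unknown on the midline, the only part of the cell outside
    \<open>L \<union> R\<close>; it is a null set.\<close>
  moreover have "negligible {z :: real \<times> real. z \<bullet> (1, 0) = xpt M r}"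
    by (rule negligible_standard_hyperplane) (simp add: Basis_prod_def)
  then have "negligible {z \<in> (L \<union> R) - cell M r s. U z \<noteq> 0}"
      "negligible {z \<in> cell M r s - (L \<union> R). U z \<noteq> 0}"
    using order by (auto simp: L_eq R_eq cell_def elim!: negligible_subset)
  ultimately have
    "(U has_integral (dx M * dy M / 2) *\<^sub>R w1 + (dx M * dy M / 2) *\<^sub>R w2) (cell M r s)"
    using has_integral_spike_set_eq by blast
  then show ?thesis
    using assms(1,2)
    by (simp add: cell_avg_def integral_unique scaleR_add_right)
qed

text \<open>In the plane, every point in the closure of an open set is a limit point. Hence the
  one-sided limit at a node, even on an interface, is unique.\<close>

lemma node_islimpt_quarter_cell:
  assumes "dx M > 0" "dy M > 0" "\<bar>\<xi>\<bar> \<le> 1" "\<bar>\<eta>\<bar> \<le> 1"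
  shows "(xnode M r \<xi>, ynode M s \<eta>) islimpt quarter_cell M r s"
proof -
  let ?a = "(xnode M r \<xi>, ynode M s \<eta>)"
  have "\<bar>dx M / 4 * \<xi>\<bar> \<le> dx M / 4 * 1" "\<bar>dy M / 4 * \<eta>\<bar> \<le> dy M / 4 * 1"
    using assms by (simp_all add: abs_mult)
  then have "?a \<in> closure (quarter_cell M r s)"
    using assms(1,2) unfolding quarter_cell_def
    by (simp add: closure_Times xnode_def ynode_def xpt_def ypt_def algebra_simps abs_le_iff)
  moreover have "open (quarter_cell M r s)"
    by (simp add: quarter_cell_def open_Times)
  ultimately show ?thesis
    by (metis islimpt_closure_open limpt_of_closure)
qed

lemma Lim_within_const:
  fixes f :: "'a::t2_space \<Rightarrow> 'b::t2_space"
  assumes "a islimpt S" and "\<And>z. z \<in> S \<Longrightarrow> f z = w"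
  shows "Lim (at a within S) f = w"
proof (rule tendsto_Lim)
  show "\<not> trivial_limit (at a within S)"
    using assms(1) by (simp add: trivial_limit_within)
  show "(f \<longlongrightarrow> w) (at a within S)"
    by (rule tendsto_eventually) (simp add: eventually_at_filter assms(2))
qed

lemma nodal_admissible_0I:
  assumes "dx M > 0" "dy M > 0"
    and "\<And>i j \<sigma> \<sigma>'. i \<in> xindices M \<Longrightarrow> j \<in> yindices M \<Longrightarrow> \<sigma> \<in> {-1, 1} \<Longrightarrow> \<sigma>' \<in> {-1, 1} \<Longrightarrow>
      \<exists>w\<in>admissible. \<forall>z\<in>quarter_cell M (i + \<sigma>/4) (j + \<sigma>'/4). U z = w"
  shows "nodal_admissible M 0 U"
  unfolding nodal_admissible_def num_gauss_0 num_lobatto_0 gauss_nodes_1 lobatto_nodes_2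
proof (intro ballI, clarify)
  fix i j and \<sigma> \<sigma>' \<xi> \<eta> :: real
  assume ij: "i \<in> xindices M" "j \<in> yindices M" "\<sigma> \<in> {-1, 1}" "\<sigma>' \<in> {-1, 1}"
    and "(\<xi>, \<eta>) \<in> {0} \<times> {-1, 1} \<union> {-1, 1} \<times> {0}"
  then have "\<bar>\<xi>\<bar> \<le> 1" "\<bar>\<eta>\<bar> \<le> 1"
    by auto
  then have lp: "(xnode M (i + \<sigma>/4) \<xi>, ynode M (j + \<sigma>'/4) \<eta>)
      islimpt quarter_cell M (i + \<sigma>/4) (j + \<sigma>'/4)"
    using assms(1,2) by (intro node_islimpt_quarter_cell)
  obtain w where "w \<in> admissible" "\<forall>z\<in>quarter_cell M (i + \<sigma>/4) (j + \<sigma>'/4). U z = w"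
    using assms(3)[OF ij] by auto
  with Lim_within_const[OF lp, of U w]
  show "Lim (at (xnode M (i + \<sigma>/4) \<xi>, ynode M (j + \<sigma>'/4) \<eta>)
      within quarter_cell M (i + \<sigma>/4) (j + \<sigma>'/4)) U \<in> admissible"
    by simp
qed


section \<open>The counterexample\<close>

text \<open>The ideal law with gamma = 2, where the factor gamma - 1 is 1.\<close>

definition ideal_gas2 :: "real \<Rightarrow> real \<Rightarrow> real" where
  "ideal_gas2 \<rho> e = \<rho> * e"

text \<open>The energy entry makes \<open>e\<close> the internal energy. Velocity and field are
  parallel, which leaves \<open>b\<close> visible in the momentum flux only.\<close>

definition aligned_state :: "real \<Rightarrow> real \<Rightarrow> state" where
  "aligned_state b e = (1, axis 1 1, b *\<^sub>R axis 1 1, 1/2 + b\<^sup>2 / 2 + e)"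

lemma eos_ideal_gas2: "eos ideal_gas2"
  by (simp add: eos_def ideal_gas2_def zero_less_mult_iff)

lemma aligned_state_simps:
  "dens (aligned_state b e) = 1"
  "mom (aligned_state b e) = axis 1 1"
  "mag (aligned_state b e) = b *\<^sub>R axis 1 1"
  "energy (aligned_state b e) = 1/2 + b\<^sup>2 / 2 + e"
  "vel (aligned_state b e) = axis 1 1"
  "internal_energy (aligned_state b e) = e"
  "spec_internal_energy (aligned_state b e) = e"
  "pressure ideal_gas2 (aligned_state b e) = e"
  by (simp_all add: aligned_state_def dens_def mom_def mag_def energy_def vel_def
      internal_energy_def spec_internal_energy_def pressure_def ideal_gas2_def)

lemma aligned_state_admissible: "e > 0 \<Longrightarrow> aligned_state b e \<in> admissible"
  by (simp add: admissible_def aligned_state_simps)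

text \<open>In the momentum, tension -b^2 and magnetic pressure b^2/2 leave -b^2/2. In the energy,
  magnetic energy and magnetic pressure add up to b^2, which B_1 (v.B) cancels.\<close>

lemma flux_aligned_state:
  "flux ideal_gas2 1 (aligned_state b e) = (1, (1 + e - b\<^sup>2 / 2) *\<^sub>R axis 1 1, 0, 1/2 + 2 * e)"
  by (simp add: flux_def Let_def aligned_state_simps inner_axis power2_eq_square)
     (simp add: vec_eq_iff axis_def field_simps)

lemma fast_speed_aligned_state:
  assumes "\<bar>b\<bar> \<le> 2" "0 < e" "e \<le> 1"
  shows "fast_speed ideal_gas2 l (aligned_state b e) \<le> 3"
proof -
  let ?U = "aligned_state b e"
  have "(sound_speed ideal_gas2 ?U)\<^sup>2 = e / 2"
    using assms by (simp add: sound_speed_def aligned_state_simps power_divide power2_eq_square)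
  moreover have "b\<^sup>2 \<le> 4"
    using assms(1) abs_le_square_iff[of b 2] by simp
  \<comment> \<open>The sum is at most 4 + 1/2, well below 9.\<close>
  ultimately have "(norm (mag ?U))\<^sup>2 / dens ?U + (sound_speed ideal_gas2 ?U)\<^sup>2 \<le> 3\<^sup>2"
    using assms(3) by (simp add: aligned_state_simps)
  then have "sqrt ((norm (mag ?U))\<^sup>2 / dens ?U + (sound_speed ideal_gas2 ?U)\<^sup>2) \<le> 3"
    by (intro real_le_lsqrt) auto
  then show ?thesis
    using fast_speed_bounds(2)[of ?U ideal_gas2 l] by (simp add: aligned_state_simps(1))
qed

text \<open>5 = 1 + 3 + 1: velocities and their weighted mean are at most 1, fast speeds at most 3,
  and the field jump is at most 2, divided by 1 + 1.\<close>

lemma wave_bound_aligned_state: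
  assumes "0 \<le> b" "b \<le> 2" "0 < e" "e \<le> 1" "0 \<le> b'" "b' \<le> 2" "0 < e'" "e' \<le> 1"
  shows "wave_bound ideal_gas2 l (aligned_state b e) (aligned_state b' e') \<le> 5"
proof -
  have "\<bar>axis (1::3) (1::real) $ l\<bar> \<le> 1"
    by (simp add: axis_def)
  moreover have "norm (b *\<^sub>R axis (1::3) (1::real) - b' *\<^sub>R axis 1 1) \<le> 2"
    using assms by (simp add: flip: scaleR_left.diff)
  ultimately show ?thesis
    using fast_speed_aligned_state[of b e l] fast_speed_aligned_state[of b' e' l] assms
    by (simp add: wave_bound_def aligned_state_simps(1,3,5))
qed

text \<open>Two cells in x let the dual field alternate and still be periodic; nothing varies in y,
  so one cell suffices there.\<close>

definition strip_mesh :: mesh where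
  "strip_mesh = \<lparr>xorg = 0, yorg = 0, dx = 1, dy = 1, nx = 2, ny = 1\<rparr>"

lemma strip_mesh_simps:
  "dx strip_mesh = 1" "dy strip_mesh = 1" "nx strip_mesh = 2" "ny strip_mesh = 1"
  "xpt strip_mesh r = r" "ypt strip_mesh r = r"
  "xindices strip_mesh = {0, 1}" "yindices strip_mesh = {0}"
  "xnode strip_mesh r \<xi> = r + \<xi> / 4" "ynode strip_mesh r \<xi> = r + \<xi> / 4"
  "xgauss_set strip_mesh 0 r = {r - 1/4, r + 1/4}"
  "ygauss_set strip_mesh 0 r = {r - 1/4, r + 1/4}"
  by (auto simp: strip_mesh_def xpt_def ypt_def xindices_def yindices_def xnode_def ynode_def
      xgauss_set_def ygauss_set_def num_gauss_0 gauss_nodes_1)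

definition primal_data :: "real \<Rightarrow> real \<times> real \<Rightarrow> state" where
  "primal_data \<delta> = (\<lambda>z. aligned_state 1 (\<delta>\<^sup>2))"

text \<open>With unit steps and origin 0, the floor of x is the index of the dual cell, and its
  parity has the period 2 of the mesh.\<close>

definition dual_data :: "real \<Rightarrow> real \<times> real \<Rightarrow> state" where
  "dual_data \<delta> =
    (\<lambda>(x, y). aligned_state (if even \<lfloor>x\<rfloor> then 1 + \<delta> else 1 - \<delta>) (\<delta>\<^sup>2 / 2))"

lemma dual_data_on_strip:
  assumes "of_int i < x" "x < of_int i + 1"
  shows "dual_data \<delta> (x, y) = aligned_state (if even i then 1 + \<delta> else 1 - \<delta>) (\<delta>\<^sup>2 / 2)"
proof -
  have "\<lfloor>x\<rfloor> = i"
    using assms by (simp add: floor_eq_iff)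
  then show ?thesis
    by (simp add: dual_data_def)
qed

section \<open>Piecewise constancy, averages and admissibility of the data\<close>

lemma primal_solution_primal_data: "primal_solution strip_mesh 0 (primal_data \<delta>)"
  unfolding primal_solution_def
  by (auto simp: periodic_ext_def primal_data_def intro: poly_on_const)

lemma dual_solution_dual_data: "dual_solution strip_mesh 0 (dual_data \<delta>)"
  unfolding dual_solution_def
proof (intro conjI ballI)
  show "periodic_ext strip_mesh (dual_data \<delta>)"
    by (simp add: periodic_ext_def dual_data_def strip_mesh_simps)
  fix i j
  have "dual_data \<delta> z = aligned_state (if even i then 1 + \<delta> else 1 - \<delta>) (\<delta>\<^sup>2 / 2)"
    if "z \<in> cell strip_mesh (of_int i + 1/2) (of_int j + 1/2)" for z
    using that dual_data_on_strip[of i] by (auto simp: cell_def strip_mesh_simps)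
  then show "poly_on 0 (cell strip_mesh (of_int i + 1/2) (of_int j + 1/2)) (dual_data \<delta>)"
    by (rule poly_on_const)
qed

lemma cell_avg_primal_data: "cell_avg strip_mesh (primal_data \<delta>) r s = aligned_state 1 (\<delta>\<^sup>2)"
  by (rule cell_avg_const) (simp_all add: strip_mesh_simps primal_data_def)

lemma cell_avg_dual_data_dual:
  "cell_avg strip_mesh (dual_data \<delta>) (of_int i + 1/2) s
    = aligned_state (if even i then 1 + \<delta> else 1 - \<delta>) (\<delta>\<^sup>2 / 2)"
proof (rule cell_avg_const)
  fix z assume "z \<in> cell strip_mesh (of_int i + 1/2) s"
  then show "dual_data \<delta> z = aligned_state (if even i then 1 + \<delta> else 1 - \<delta>) (\<delta>\<^sup>2 / 2)"
    using dual_data_on_strip[of i] by (auto simp: cell_def strip_mesh_simps)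
qed (simp_all add: strip_mesh_simps)

text \<open>The mean of the magnetic energies exceeds the energy of the mean field by \<delta>^2/2;
  added to the internal energy \<delta>^2/2 this gives the primal value \<delta>^2.\<close>

lemma cell_avg_dual_data_primal:
  "cell_avg strip_mesh (dual_data \<delta>) 0 0 = aligned_state 1 (\<delta>\<^sup>2)"
proof -
  have "cell_avg strip_mesh (dual_data \<delta>) 0 0
    = (1/2) *\<^sub>R (aligned_state (1 - \<delta>) (\<delta>\<^sup>2 / 2) + aligned_state (1 + \<delta>) (\<delta>\<^sup>2 / 2))"
    \<comment> \<open>The line x = 0 splits the primal cell; its left half lies in the odd dual cell
      -1, with field 1 - \<delta>.\<close>
    using dual_data_on_strip[of "-1"] dual_data_on_strip[of 0]
    by (intro cell_avg_two_halves) (simp_all add: strip_mesh_simps cell_def)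
  also have "\<dots> = aligned_state 1 (\<delta>\<^sup>2)"
    by (simp add: aligned_state_def vec_eq_iff axis_def power2_eq_square field_simps)
  finally show ?thesis .
qed

lemma averages_admissible_data:
  assumes "\<delta> \<noteq> 0"
  shows "averages_admissible strip_mesh (primal_data \<delta>) (dual_data \<delta>)"
  using assms
  by (simp add: averages_admissible_def cell_avg_primal_data cell_avg_dual_data_dual
      aligned_state_admissible)

lemma nodal_admissible_primal_data:
  assumes "\<delta> \<noteq> 0"
  shows "nodal_admissible strip_mesh 0 (primal_data \<delta>)"
  using assms
  by (intro nodal_admissible_0I)
     (auto simp: strip_mesh_simps primal_data_def aligned_state_admissible)

lemma nodal_admissible_dual_data:
  assumes "\<delta> \<noteq> 0"
  shows "nodal_admissible strip_mesh 0 (dual_data \<delta>)"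
proof (rule nodal_admissible_0I)
  fix i j :: int and \<sigma> \<sigma>' :: real
  assume \<sigma>: "\<sigma> \<in> {-1, 1}"
  \<comment> \<open>Dual cell i starts at the center of primal cell i, so the left half of the
    primal cell belongs to dual cell i - 1.\<close>
  define i' where "i' = (if \<sigma> = 1 then i else i - 1)"
  have "dual_data \<delta> z = aligned_state (if even i' then 1 + \<delta> else 1 - \<delta>) (\<delta>\<^sup>2 / 2)"
    if "z \<in> quarter_cell strip_mesh (of_int i + \<sigma>/4) (of_int j + \<sigma>'/4)" for z
    using that dual_data_on_strip[of i'] \<sigma>
    by (auto simp: quarter_cell_def strip_mesh_simps i'_def)
  then show "\<exists>w\<in>admissible.
      \<forall>z\<in>quarter_cell strip_mesh (of_int i + \<sigma>/4) (of_int j + \<sigma>'/4). dual_data \<delta> z = w"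
    using assms
    by (intro bexI[of _ "aligned_state (if even i' then 1 + \<delta> else 1 - \<delta>) (\<delta>\<^sup>2 / 2)"])
       (auto intro: aligned_state_admissible)
qed (simp_all add: strip_mesh_simps)

section \<open>Divergence and update on the primal cell (0, 0)\<close>

lemma dual_data_half:
  "dual_data \<delta> (1/2, y) = aligned_state (1 + \<delta>) (\<delta>\<^sup>2 / 2)"
  "dual_data \<delta> (-(1/2), y) = aligned_state (1 - \<delta>) (\<delta>\<^sup>2 / 2)"
  using dual_data_on_strip[of 0 "1/2"] dual_data_on_strip[of "-1" "-(1/2)"] by simp_all

text \<open>Cancels the contributions of the top and bottom faces.\<close>

lemma dual_data_y: "dual_data \<delta> (x, y) = dual_data \<delta> (x, y')"
  by (simp add: dual_data_def)

lemma discrete_div_dual_data: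
  "discrete_div strip_mesh 0 (dual_data \<delta>) 0 0 = 2 * \<delta>"
  unfolding discrete_div_def num_gauss_0 gauss_nodes_1
  by (simp add: strip_mesh_simps gauss_weight_1 dual_data_half aligned_state_simps
      dual_data_y[of \<delta> _ "1/2" "-(1/2)"])

text \<open>Both averages agree, so \<open>\<tau>\<close> drops out. Only the momentum flux jumps,
  by -((1+\<delta>)^2 - (1-\<delta>)^2)/2 = -2\<delta>, and it enters with a minus sign.\<close>

lemma cdg_op_data:
  "cdg_op ideal_gas2 strip_mesh 0 \<tau> (primal_data \<delta>) (dual_data \<delta>) 0 0
    = (0, (2 * \<delta>) *\<^sub>R axis 1 1, 0, 0)"
  unfolding cdg_op_def num_gauss_0 gauss_nodes_1
  by (simp add: strip_mesh_simps gauss_weight_1 dual_data_half flux_aligned_state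
      dual_data_y[of \<delta> _ "1/2" "-(1/2)"] cell_avg_primal_data cell_avg_dual_data_primal)
     (simp add: zero_prod_def vec_eq_iff axis_def power2_eq_square field_simps)

text \<open>Total energy and field stay fixed while the kinetic energy rises from 1/2 to (1 +
  2t\<delta>)^2/2.\<close>

lemma updated_internal_energy:
  "internal_energy (aligned_state 1 (\<delta>\<^sup>2) + t *\<^sub>R (0, (2 * \<delta>) *\<^sub>R axis 1 1, 0, 0))
    = \<delta>\<^sup>2 - 2 * t * \<delta> - 2 * (t * \<delta>)\<^sup>2"
proof -
  have "axis 1 1 + (t * (2 * \<delta>)) *\<^sub>R axis (1::3) (1::real) = (1 + 2 * \<delta> * t) *\<^sub>R axis 1 1"
    by (simp add: scaleR_left.add)
  then have "(norm (axis 1 1 + (t * (2 * \<delta>)) *\<^sub>R axis (1::3) (1::real)))\<^sup>2 = (1 + 2 * \<delta> * t)\<^sup>2"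
    by simp
  then show ?thesis
    by (simp add: internal_energy_def aligned_state_def energy_def mom_def mag_def dens_def)
       (simp add: power2_eq_square algebra_simps)
qed

lemma wave_speed_bounds:
  assumes "0 < \<delta>" "\<delta> \<le> 1"
  shows "1 \<le> wave_speed1 ideal_gas2 strip_mesh 0 (primal_data \<delta>) (dual_data \<delta>)"
    and "wave_speed1 ideal_gas2 strip_mesh 0 (primal_data \<delta>) (dual_data \<delta>) \<le> 5"
    and "0 \<le> wave_speed2 ideal_gas2 strip_mesh 0 (primal_data \<delta>) (dual_data \<delta>)"
    and "wave_speed2 ideal_gas2 strip_mesh 0 (primal_data \<delta>) (dual_data \<delta>) \<le> 5"
proof -
  \<comment> \<open>\<open>S\<close> contains all values of both solutions and does not depend on
    \<open>\<delta>\<close>, so the bounds are uniform.\<close>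
  define S where "S = {aligned_state b e | b e. 0 \<le> b \<and> b \<le> 2 \<and> 0 < e \<and> e \<le> 1}"
  have \<delta>2: "0 < \<delta>\<^sup>2" "\<delta>\<^sup>2 \<le> 1"
    using assms by (simp_all add: power_le_one)
  have P: "primal_data \<delta> z \<in> S" for z
    unfolding S_def primal_data_def using \<delta>2 by fastforce
  have D: "dual_data \<delta> z \<in> S" for z
    unfolding S_def dual_data_def using \<delta>2 assms by (cases z) fastforce
  have upper: "wave_bound ideal_gas2 l U W \<le> 5" if "U \<in> S" "W \<in> S" for l U W
    using that wave_bound_aligned_state unfolding S_def by blast
  \<comment> \<open>The velocity is (1, 0, 0): this yields 1 in the x-direction and 0 in the
    y-direction.\<close>
  have lower: "\<bar>axis 1 1 $ l\<bar> \<le> wave_bound ideal_gas2 l U W" if "U \<in> S" "W \<in> S" for l U W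
  proof -
    have "dens U > 0" "dens W > 0" "vel U = axis 1 1"
      using that by (auto simp: S_def aligned_state_simps)
    then show ?thesis
      by (metis wave_bound_ge_vel)
  qed
  show "1 \<le> wave_speed1 ideal_gas2 strip_mesh 0 (primal_data \<delta>) (dual_data \<delta>)"
    unfolding wave_speed1_def strip_mesh_simps
    using lower[OF P P, of 1] by (subst Max_ge_iff) auto
  show "0 \<le> wave_speed2 ideal_gas2 strip_mesh 0 (primal_data \<delta>) (dual_data \<delta>)"
    unfolding wave_speed2_def strip_mesh_simps
    using order_trans[OF abs_ge_zero lower[OF P P], of 2] by (subst Max_ge_iff) auto
  show "wave_speed1 ideal_gas2 strip_mesh 0 (primal_data \<delta>) (dual_data \<delta>) \<le> 5"
    unfolding wave_speed1_def strip_mesh_simps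
    by (subst Max_le_iff) (auto intro: upper P D)
  show "wave_speed2 ideal_gas2 strip_mesh 0 (primal_data \<delta>) (dual_data \<delta>) \<le> 5"
    unfolding wave_speed2_def strip_mesh_simps
    by (subst Max_le_iff) (auto intro: upper P D)
qed

theorem theorem4p4:
  fixes C \<theta> :: real
  assumes "C > 0" and "0 < \<theta>" and "\<theta> \<le> 1"
  shows "\<exists>(p :: real \<Rightarrow> real \<Rightarrow> real) (k :: nat) (M :: mesh)
           (UC :: real \<times> real \<Rightarrow> state) (UD :: real \<times> real \<Rightarrow> state) (\<tau>\<^sub>m\<^sub>a\<^sub>x :: real).
           eos p \<and> valid_mesh M \<and> primal_solution M k UC \<and> dual_solution M k UD \<and>
           averages_admissible M UC UD \<and> nodal_admissible M k UC \<and> nodal_admissible M k UD \<and>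
           \<not> discrete_div_free M k UC UD \<and>
           \<tau>\<^sub>m\<^sub>a\<^sub>x * (wave_speed1 p M k UC UD / dx M + wave_speed2 p M k UC UD / dy M) = C \<and>
           \<not> positivity_preserving p M k \<tau>\<^sub>m\<^sub>a\<^sub>x (\<theta> * \<tau>\<^sub>m\<^sub>a\<^sub>x) UC UD"
proof -
  \<comment> \<open>The 10 is the upper bound 5 + 5 on the sum of the wave speeds, so that
    \<open>\<delta>\<close> stays below the time step; the cap 1 meets the hypothesis of
    \<open>wave_speed_bounds\<close>.\<close>
  define \<delta> where "\<delta> = min 1 (\<theta> * C / 10)"
  have \<delta>: "0 < \<delta>" "\<delta> \<le> 1" "\<delta> \<le> \<theta> * C / 10"
    using assms by (simp_all add: \<delta>_def)
  let ?UC = "primal_data \<delta>" and ?UD = "dual_data \<delta>" and ?p = ideal_gas2 and ?M = strip_mesh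
  \<comment> \<open>Both step sizes are 1, so the CFL relation forces the maximal time step
    \<open>C / a\<close>.\<close>
  define a where "a = wave_speed1 ?p ?M 0 ?UC ?UD + wave_speed2 ?p ?M 0 ?UC ?UD"
  have a: "1 \<le> a" "a \<le> 10"
    unfolding a_def using wave_speed_bounds[OF \<delta>(1,2)] by linarith+
  define t where "t = \<theta> * (C / a)"
  have "\<theta> * C / 10 \<le> \<theta> * C / a"
    using a assms by (intro divide_left_mono) auto
  then have t: "\<delta> \<le> t"
    unfolding t_def times_divide_eq_right using \<delta>(3) by linarith
  \<comment> \<open>From \<open>\<delta> \<le> t\<close> follows t\<delta> \<ge> \<delta>^2, so the
    first two terms sum to at most -\<delta>^2.\<close>
  have "\<delta>\<^sup>2 - 2 * t * \<delta> - 2 * (t * \<delta>)\<^sup>2 < 0"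
    using mult_right_mono[OF t, of \<delta>] \<delta>(1) mult_pos_pos[OF \<delta>(1) \<delta>(1)] zero_le_power2[of "t * \<delta>"]
    unfolding power2_eq_square by linarith
  then have "cell_avg ?M ?UC 0 0 + t *\<^sub>R cdg_op ?p ?M 0 (C / a) ?UC ?UD 0 0 \<notin> admissible"
    by (simp only: admissible_def cell_avg_primal_data cdg_op_data mem_Collect_eq
        updated_internal_energy) simp
  then have "\<not> positivity_preserving ?p ?M 0 (C / a) (\<theta> * (C / a)) ?UC ?UD"
    by (auto simp: positivity_preserving_def strip_mesh_simps(7,8) t_def)
  moreover have "\<not> discrete_div_free ?M 0 ?UC ?UD"
    using \<delta>(1) by (simp add: discrete_div_free_def strip_mesh_simps(7,8) discrete_div_dual_data)
  moreover have "C / a * (wave_speed1 ?p ?M 0 ?UC ?UD / dx ?M + wave_speed2 ?p ?M 0 ?UC ?UD / dy ?M)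
      = C"
    using a by (simp add: strip_mesh_simps(1,2) flip: a_def)
  moreover have "valid_mesh ?M"
    by (simp add: valid_mesh_def strip_mesh_simps)
  moreover have "\<delta> \<noteq> 0"
    using \<delta>(1) by simp
  ultimately show ?thesis
    using eos_ideal_gas2 primal_solution_primal_data dual_solution_dual_data
      averages_admissible_data nodal_admissible_primal_data nodal_admissible_dual_data
    by blast
qed

end
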